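(* Let $k_1,k_2$ be integers with $k_1\neq0$, $k_2\neq0$, $k_1\neq k_2$. Suppose that the $C^*$-dynamical system $(\mathfrak A,\alpha,\omega)$ is compact, i.e. $\mathcal H_\omega$ is generated (as a closed subspace) by the eigenvectors of $U_\omega$. Then for all $A_0,A_1,A_2\in\mathfrak A$, $$\lim_{N\to+\infty}\frac1N\sum_{n=0}^{N-1}\omega\left(A_0\alpha^{nk_1}(A_1)\alpha^{nk_2}(A_2)\right)=\left\langle S(\pi_\omega(A_1))\pi_\omega(A_2)\Omega,\pi_\omega(A_0^* )\Omega\right\rangle,$$ where, for $A\in\mathcal B(\mathcal H_\omega)$, $$S(A)=\sum_{\{v,w\in\sigma_{\rm pp}(U_\omega)\,\mid\, v^{k_1}w^{k_2-k_1}=1\}}E^{U_\omega}_vAE^{U_\omega}_w,$$ the series converging in the strong operator topology.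
   Context: A (discrete) $C^*$-dynamical system $(\mathfrak A,\alpha,\omega)$ consists of a unital $C^*$-algebra $\mathfrak A$, a $*$-automorphism $\alpha$, and a state $\omega$ with $\omega\circ\alpha=\omega$. Inner products are linear in the first variable. $(\mathcal H_\omega,\pi_\omega,U_\omega,\Omega)$ is the covariant GNS representation: $\omega(A)=\langle\pi_\omega(A)\Omega,\Omega\rangle$, $U_\omega$ unitary, $U_\omega\Omega=\Omega$, $U_\omega\pi_\omega(A)U_\omega^*=\pi_\omega(\alpha(A))$. $\sigma_{\rm pp}(U_\omega)$ is the set of eigenvalues of $U_\omega$, and $E^{U_\omega}_z$ is the orthogonal projection onto the eigenspace of $U_\omega$ for $z\in\mathbb T$. *)

theory Defs
  imports "HOL-Analysis.Analysis"
begin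

subsection \<open>Complex vector spaces and Hilbert spaces\<close>

class complex_vector = real_vector +
  fixes scaleC :: "complex \<Rightarrow> 'a \<Rightarrow> 'a" (infixr "*\<^sub>C" 75)
  assumes scaleC_add_right: "c *\<^sub>C (x + y) = c *\<^sub>C x + c *\<^sub>C y"
    and scaleC_add_left: "(c + d) *\<^sub>C x = c *\<^sub>C x + d *\<^sub>C x"
    and scaleC_scaleC: "c *\<^sub>C d *\<^sub>C x = (c * d) *\<^sub>C x"
    and scaleC_one: "1 *\<^sub>C x = x"
    and scaleR_eq_scaleC: "r *\<^sub>R x = complex_of_real r *\<^sub>C x"

global_interpretation complex_vector: vector_space "scaleC :: complex \<Rightarrow> 'a \<Rightarrow> 'a::complex_vector"
  by unfold_locales (fact scaleC_add_right scaleC_add_left scaleC_scaleC scaleC_one)+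

instantiation complex :: complex_vector
begin

definition scaleC_complex :: "complex \<Rightarrow> complex \<Rightarrow> complex"
  where "scaleC_complex = (*)"

instance
  by standard (auto simp: scaleC_complex_def algebra_simps scaleR_conv_of_real)

end

abbreviation clinear :: "('a::complex_vector \<Rightarrow> 'b::complex_vector) \<Rightarrow> bool"
  where "clinear \<equiv> Vector_Spaces.linear scaleC scaleC"

text \<open>The inner product is linear in the first variable.\<close>

class complex_inner = complex_vector + real_normed_vector +
  fixes cinner :: "'a \<Rightarrow> 'a \<Rightarrow> complex"
  assumes cinner_commute: "cinner x y = cnj (cinner y x)"
    and cinner_add_left: "cinner (x + y) z = cinner x z + cinner y z"
    and cinner_scaleC_left: "cinner (c *\<^sub>C x) y = c * cinner x y"
    and cinner_ge_zero: "0 \<le> Re (cinner x x)"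
    and cinner_eq_zero_iff: "cinner x x = 0 \<longleftrightarrow> x = 0"
    and norm_eq_sqrt_cinner: "norm x = sqrt (Re (cinner x x))"

class chilbert_space = complex_inner + complete_space


subsection \<open>Operators on a Hilbert space\<close>

definition bounded_clinear :: "('h::chilbert_space \<Rightarrow> 'h) \<Rightarrow> bool"
  where "bounded_clinear T \<longleftrightarrow> clinear T \<and> (\<exists>K. \<forall>x. norm (T x) \<le> K * norm x)"

definition is_cadjoint :: "('h::chilbert_space \<Rightarrow> 'h) \<Rightarrow> ('h \<Rightarrow> 'h) \<Rightarrow> bool"
  where "is_cadjoint T S \<longleftrightarrow> (\<forall>x y. cinner (T x) y = cinner x (S y))"

definition cadjoint :: "('h::chilbert_space \<Rightarrow> 'h) \<Rightarrow> 'h \<Rightarrow> 'h"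
  where "cadjoint T = (THE S. is_cadjoint T S)"

definition unitary :: "('h::chilbert_space \<Rightarrow> 'h) \<Rightarrow> bool"
  where "unitary U \<longleftrightarrow> clinear U \<and> surj U \<and> (\<forall>x y. cinner (U x) (U y) = cinner x y)"

definition orth_proj :: "'h::chilbert_space set \<Rightarrow> 'h \<Rightarrow> 'h"
  where "orth_proj M x = (THE y. y \<in> M \<and> (\<forall>m\<in>M. cinner (x - y) m = 0))"

definition eigenspace :: "('h::chilbert_space \<Rightarrow> 'h) \<Rightarrow> complex \<Rightarrow> 'h set"
  where "eigenspace T z = {x. T x = z *\<^sub>C x}"

definition eigenvectors :: "('h::chilbert_space \<Rightarrow> 'h) \<Rightarrow> 'h set"
  where "eigenvectors T = {x. x \<noteq> 0 \<and> (\<exists>z. T x = z *\<^sub>C x)}"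

definition eigenvalues :: "('h::chilbert_space \<Rightarrow> 'h) \<Rightarrow> complex set"
  where "eigenvalues T = {z. \<exists>x. x \<noteq> 0 \<and> T x = z *\<^sub>C x}"

abbreviation eigenproj :: "('h::chilbert_space \<Rightarrow> 'h) \<Rightarrow> complex \<Rightarrow> 'h \<Rightarrow> 'h"
  where "eigenproj T z \<equiv> orth_proj (eigenspace T z)"

text \<open>Convergence in the strong operator topology of the net of finite partial sums.\<close>

definition has_sum_strong :: "('i \<Rightarrow> 'h::chilbert_space \<Rightarrow> 'h) \<Rightarrow> ('h \<Rightarrow> 'h) \<Rightarrow> 'i set \<Rightarrow> bool"
  where "has_sum_strong F T I \<longleftrightarrow> (\<forall>x. ((\<lambda>i. F i x) has_sum T x) I)"


subsection \<open>Unital $C^*$-algebras and dynamical systems\<close>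

text \<open>The class \<^class>\<open>real_normed_algebra_1\<close> requires \<open>1 \<noteq> 0\<close> and \<open>norm 1 = 1\<close>. Only the zero
  algebra, which carries no state, is thereby excluded.\<close>

class cstar_algebra = complex_vector + real_normed_algebra_1 + complete_space +
  fixes star :: "'a \<Rightarrow> 'a"
  assumes scaleC_mult_left: "(c *\<^sub>C x) * y = c *\<^sub>C (x * y)"
    and scaleC_mult_right: "x * (c *\<^sub>C y) = c *\<^sub>C (x * y)"
    and norm_scaleC: "norm (c *\<^sub>C x) = cmod c * norm x"
    and star_add: "star (x + y) = star x + star y"
    and star_scaleC: "star (c *\<^sub>C x) = cnj c *\<^sub>C star x"
    and star_mult: "star (x * y) = star y * star x"
    and star_star: "star (star x) = x"
    and cstar_identity: "norm (star x * x) = (norm x)\<^sup>2"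

definition star_automorphism :: "('a::cstar_algebra \<Rightarrow> 'a) \<Rightarrow> bool"
  where "star_automorphism \<alpha> \<longleftrightarrow> bij \<alpha> \<and> clinear \<alpha> \<and>
    (\<forall>a b. \<alpha> (a * b) = \<alpha> a * \<alpha> b) \<and> (\<forall>a. \<alpha> (star a) = star (\<alpha> a))"

definition state :: "('a::cstar_algebra \<Rightarrow> complex) \<Rightarrow> bool"
  where "state \<omega> \<longleftrightarrow> clinear \<omega> \<and> (\<forall>a. \<omega> (star a * a) \<in> \<real>\<^sub>\<ge>\<^sub>0) \<and> \<omega> 1 = 1"

definition funpow_int :: "('a \<Rightarrow> 'a) \<Rightarrow> int \<Rightarrow> 'a \<Rightarrow> 'a"
  where "funpow_int f k = (if 0 \<le> k then f ^^ nat k else inv f ^^ nat (- k))"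

locale cstar_dynamical_system =
  fixes \<alpha> :: "'a::cstar_algebra \<Rightarrow> 'a" and \<omega> :: "'a \<Rightarrow> complex"
  assumes automorphism: "star_automorphism \<alpha>"
    and state: "state \<omega>"
    and invariant: "\<omega> \<circ> \<alpha> = \<omega>"

definition star_representation :: "('a::cstar_algebra \<Rightarrow> 'h::chilbert_space \<Rightarrow> 'h) \<Rightarrow> bool"
  where "star_representation \<pi> \<longleftrightarrow>
    (\<forall>a. bounded_clinear (\<pi> a)) \<and>
    (\<forall>a b x. \<pi> (a + b) x = \<pi> a x + \<pi> b x) \<and>
    (\<forall>c a x. \<pi> (c *\<^sub>C a) x = c *\<^sub>C \<pi> a x) \<and>
    (\<forall>a b. \<pi> (a * b) = \<pi> a \<circ> \<pi> b) \<and>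
    (\<forall>a. is_cadjoint (\<pi> a) (\<pi> (star a))) \<and>
    \<pi> 1 = id"

text \<open>The covariant GNS representation is determined up to unitary equivalence by the following
  properties; \<^typ>\<open>'h\<close> is the GNS Hilbert space.\<close>

locale covariant_GNS = cstar_dynamical_system \<alpha> \<omega>
  for \<alpha> :: "'a::cstar_algebra \<Rightarrow> 'a" and \<omega> :: "'a \<Rightarrow> complex" +
  fixes \<pi> :: "'a \<Rightarrow> 'h::chilbert_space \<Rightarrow> 'h" and U :: "'h \<Rightarrow> 'h" and \<Omega> :: 'h
  assumes representation: "star_representation \<pi>"
    and cyclic: "closure (range (\<lambda>a. \<pi> a \<Omega>)) = UNIV"
    and vector_state: "\<omega> a = cinner (\<pi> a \<Omega>) \<Omega>"
    and unitary: "unitary U"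
    and fixed: "U \<Omega> = \<Omega>"
    and covariant: "U \<circ> \<pi> a \<circ> cadjoint U = \<pi> (\<alpha> a)"

text \<open>Compactness of the dynamical system, in terms of its GNS unitary \<open>U\<close>.\<close>

definition compact_system :: "('h::chilbert_space \<Rightarrow> 'h) \<Rightarrow> bool"
  where "compact_system U \<longleftrightarrow> closure (complex_vector.span (eigenvectors U)) = UNIV"

definition resonant_pairs :: "int \<Rightarrow> int \<Rightarrow> ('h::chilbert_space \<Rightarrow> 'h) \<Rightarrow> (complex \<times> complex) set"
  where "resonant_pairs k\<^sub>1 k\<^sub>2 U =
    {(v, w). v \<in> eigenvalues U \<and> w \<in> eigenvalues U \<and> v powi k\<^sub>1 * w powi (k\<^sub>2 - k\<^sub>1) = 1}"

definition resonant_sum :: "int \<Rightarrow> int \<Rightarrow> ('h::chilbert_space \<Rightarrow> 'h) \<Rightarrow> ('h \<Rightarrow> 'h) \<Rightarrow> 'h \<Rightarrow> 'h"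
  where "resonant_sum k\<^sub>1 k\<^sub>2 U A x =
    (\<Sum>\<^sub>\<infinity>(v, w)\<in>resonant_pairs k\<^sub>1 k\<^sub>2 U. (eigenproj U v \<circ> A \<circ> eigenproj U w) x)"

end

theory Submission
  imports Defs
begin

text \<open>By covariance the correlation equals
  \<open>\<langle>U\<^bsup>n k\<^sub>1\<^esup> \<pi>(A\<^sub>1) U\<^bsup>n (k\<^sub>2 - k\<^sub>1)\<^esup> x, y\<rangle>\<close> with \<open>x = \<pi>(A\<^sub>2) \<Omega>\<close> and \<open>y = \<pi>(A\<^sub>0\<^sup>*) \<Omega>\<close>. For eigenvectors
  \<open>x\<close>, \<open>y\<close> with eigenvalues \<open>w\<close>, \<open>v\<close> its average is a Cesaro mean of powers of
  \<open>v\<^bsup>k\<^sub>1\<^esup> w\<^bsup>k\<^sub>2 - k\<^sub>1\<^esup>\<close>, which selects the resonant pairs; uniform boundedness and density of the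
  span of the eigenvectors give the general case. The resonant series converges strongly because each
  eigenvalue has at most \<open>\<bar>k\<^sub>1\<bar>\<close> (respectively \<open>\<bar>k\<^sub>2 - k\<^sub>1\<bar>\<close>) resonant partners, so that its finite
  partial sums are controlled by Bessel's inequality.\<close>

section \<open>Complex inner product spaces\<close>

lemma cinner_add_right: "cinner x (y + z) = cinner x y + cinner (x::'a::complex_inner) z"
  by (metis cinner_commute cinner_add_left complex_cnj_add)

lemma cinner_scaleC_right: "cinner x (c *\<^sub>C y) = cnj c * cinner (x::'a::complex_inner) y"
  by (metis cinner_commute cinner_scaleC_left complex_cnj_mult)

lemma cinner_self: "cinner x x = complex_of_real ((norm (x::'a::complex_inner))\<^sup>2)"
proof -
  have "Im (cinner x x) = 0"
    using arg_cong[OF cinner_commute[of x x], of Im] by simp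
  moreover have "Re (cinner x x) = (norm x)\<^sup>2"
    by (simp add: norm_eq_sqrt_cinner cinner_ge_zero)
  ultimately show ?thesis
    by (simp add: complex_eq_iff)
qed

text \<open>The norm of the class is homogeneous for real scalars by axiom; complex scalars are
  handled by reading the norm off the inner product, where \<open>c\<close> and \<open>cnj c\<close>
  come out together.\<close>

lemma norm_scaleC_inner: "norm (c *\<^sub>C x) = cmod c * norm (x::'a::complex_inner)"
proof -
  have "complex_of_real ((norm (c *\<^sub>C x))\<^sup>2) = c * cnj c * complex_of_real ((norm x)\<^sup>2)"
    unfolding cinner_self[symmetric] by (simp add: cinner_scaleC_left cinner_scaleC_right)
  also have "c * cnj c = complex_of_real ((cmod c)\<^sup>2)"
    by (rule complex_norm_square[symmetric])
  finally have "complex_of_real ((norm (c *\<^sub>C x))\<^sup>2) = complex_of_real ((cmod c * norm x)\<^sup>2)"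
    by (simp only: of_real_mult[symmetric] power_mult_distrib)
  then show ?thesis
    unfolding of_real_eq_iff by (simp add: power2_eq_iff_nonneg)
qed

lemma cauchy_schwarz: "cmod (cinner x y) \<le> norm x * norm (y::'a::complex_inner)"
proof (cases "y = 0")
  case True
  have "cinner x 0 = 0"
    using cinner_scaleC_right[of x 0 0] by simp
  with True show ?thesis by simp
next
  case False
  define n where "n = (norm y)\<^sup>2"
  \<comment> \<open>With this scalar, \<open>x + c *\<^sub>C y\<close> is orthogonal to
    \<open>y\<close>, so its squared norm is what remains of that of \<open>x\<close> after removing
    the component along \<open>y\<close>; that it is nonnegative is the claim.\<close>
  define c where "c = - cinner x y / n"
  have n: "n > 0" using False by (simp add: n_def)
  have "cinner (x + c *\<^sub>C y) (x + c *\<^sub>C y)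
      = cinner x x + cnj c * cinner x y + c * cinner y x + c * cnj c * cinner y y"
    by (simp add: cinner_add_left cinner_add_right cinner_scaleC_left cinner_scaleC_right algebra_simps)
  also have "cinner y x = cnj (cinner x y)"
    by (rule cinner_commute)
  also have "cinner y y = complex_of_real n"
    by (simp add: n_def cinner_self)
  also have "c * cnj c * complex_of_real n = - c * cnj (cinner x y)"
    using n by (simp add: c_def)
  also have "cinner x x + cnj c * cinner x y + c * cnj (cinner x y) + - c * cnj (cinner x y)
      = cinner x x + cnj c * cinner x y" by simp
  also have "cnj c * cinner x y = - complex_of_real ((cmod (cinner x y))\<^sup>2 / n)"
    by (simp add: c_def complex_norm_square mult.commute del: of_real_power)
  finally have "complex_of_real ((norm (x + c *\<^sub>C y))\<^sup>2)
      = complex_of_real ((norm x)\<^sup>2 - (cmod (cinner x y))\<^sup>2 / n)"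
    by (simp add: cinner_self)
  then have "(norm (x + c *\<^sub>C y))\<^sup>2 = (norm x)\<^sup>2 - (cmod (cinner x y))\<^sup>2 / n"
    by (simp only: of_real_eq_iff)
  then have "(cmod (cinner x y))\<^sup>2 / n \<le> (norm x)\<^sup>2"
    by (metis diff_ge_0_iff_ge zero_le_power2)
  then have "(cmod (cinner x y))\<^sup>2 \<le> (norm x * norm y)\<^sup>2"
    using n by (simp add: divide_le_eq n_def power_mult_distrib)
  then show ?thesis
    by (rule power2_le_imp_le) simp
qed

text \<open>Over the reals the conjugation in the second slot disappears, so the library rules for
  sums, differences and limits apply to both arguments.\<close>

interpretation cinner: bounded_bilinear "cinner :: 'a::complex_inner \<Rightarrow> 'a \<Rightarrow> complex"
proof
  fix x y z :: 'a and r :: real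
  show "cinner (x + y) z = cinner x z + cinner y z" by (rule cinner_add_left)
  show "cinner x (y + z) = cinner x y + cinner x z" by (rule cinner_add_right)
  show "cinner (r *\<^sub>R x) y = r *\<^sub>R cinner x y"
    by (simp add: scaleR_eq_scaleC cinner_scaleC_left scaleC_complex_def)
  show "cinner x (r *\<^sub>R y) = r *\<^sub>R cinner x y"
    by (simp add: scaleR_eq_scaleC cinner_scaleC_right scaleC_complex_def)
  show "\<exists>K. \<forall>a b :: 'a. cmod (cinner a b) \<le> norm a * norm b * K"
    by (rule exI[of _ 1]) (simp add: cauchy_schwarz)
qed

lemma cinner_eqI:
  fixes x y :: "'a::complex_inner"
  assumes "\<And>z. cinner z x = cinner z y"
  shows "x = y"
  using assms[of "x - y"] cinner_eq_zero_iff[of "x - y"] by (simp add: cinner.diff_right)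

section \<open>Orthogonality, almost orthogonality and summability of families\<close>

lemma norm_add_square_orthogonal:
  fixes x y :: "'a::complex_inner"
  assumes "cinner x y = 0"
  shows "(norm (x + y))\<^sup>2 = (norm x)\<^sup>2 + (norm y)\<^sup>2"
proof -
  have "cinner y x = 0"
    using assms cinner_commute[of y x] by simp
  then have "complex_of_real ((norm (x + y))\<^sup>2) = complex_of_real ((norm x)\<^sup>2 + (norm y)\<^sup>2)"
    using assms unfolding of_real_add cinner_self[symmetric]
    by (simp add: cinner_add_left cinner_add_right)
  then show ?thesis by (simp only: of_real_eq_iff)
qed

lemma norm_sum_square_orthogonal:
  fixes f :: "'i \<Rightarrow> 'a::complex_inner"
  assumes "finite F" and "\<And>i j. i \<in> F \<Longrightarrow> j \<in> F \<Longrightarrow> i \<noteq> j \<Longrightarrow> cinner (f i) (f j) = 0"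
  shows "(norm (sum f F))\<^sup>2 = (\<Sum>i\<in>F. (norm (f i))\<^sup>2)"
  using assms
proof (induction F)
  case (insert i F)
  have "cinner (f i) (sum f F) = 0"
    unfolding cinner.sum_right using insert.hyps insert.prems by (intro sum.neutral) auto
  with insert show ?case
    by (simp add: norm_add_square_orthogonal)
qed simp

text \<open>A Schur test for the Gram matrix: each nonzero entry is bounded by the mean of two
  squared norms, and each row has at most \<open>C\<close> such entries. Orthogonal families are the
  case \<open>C = 1\<close>.\<close>

lemma norm_sum_square_le_almost_orthogonal:
  fixes f :: "'i \<Rightarrow> 'a::complex_inner"
  assumes "finite F"
    and card: "\<And>i. i \<in> F \<Longrightarrow> card {j\<in>F. cinner (f i) (f j) \<noteq> 0} \<le> C"
  shows "(norm (sum f F))\<^sup>2 \<le> real C * (\<Sum>i\<in>F. (norm (f i))\<^sup>2)"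
proof -
  \<comment> \<open>The 0/1 pattern of the nonzero Gram entries; it is symmetric because swapping
    the arguments only conjugates the inner product.\<close>
  define p where "p i j = (if cinner (f i) (f j) = 0 then 0 else 1 :: real)" for i j
  have sym: "p i j = p j i" for i j
    unfolding p_def by (metis cinner_commute complex_cnj_zero_iff)
  have row: "(\<Sum>j\<in>F. p i j) \<le> real C" if "i \<in> F" for i
  proof -
    have "(\<Sum>j\<in>F. p i j) = real (card {j\<in>F. cinner (f i) (f j) \<noteq> 0})"
      using \<open>finite F\<close> by (simp add: p_def sum.If_cases Int_def)
    with card[OF that] show ?thesis by simp
  qed
  have "(norm (sum f F))\<^sup>2 = Re (\<Sum>i\<in>F. \<Sum>j\<in>F. cinner (f i) (f j))"
    unfolding cinner.sum_right[symmetric] cinner.sum_left[symmetric] cinner_self by simp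
  \<comment> \<open>The second term is written with \<open>p j i\<close>, so that exchanging the two
    sums turns it into the first one.\<close>
  also have "\<dots> \<le> (\<Sum>i\<in>F. \<Sum>j\<in>F. p i j * ((norm (f i))\<^sup>2 / 2) + p j i * ((norm (f j))\<^sup>2 / 2))"
    unfolding Re_sum
  proof (intro sum_mono)
    fix i j
    have "Re (cinner (f i) (f j)) \<le> norm (f i) * norm (f j)"
      using cauchy_schwarz[of "f i" "f j"] complex_Re_le_cmod order_trans by blast
    also have "\<dots> \<le> (norm (f i))\<^sup>2 / 2 + (norm (f j))\<^sup>2 / 2"
      using sum_squares_bound[of "norm (f i)" "norm (f j)"] by simp
    finally show "Re (cinner (f i) (f j)) \<le> p i j * ((norm (f i))\<^sup>2 / 2) + p j i * ((norm (f j))\<^sup>2 / 2)"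
      using sym[of i j] by (auto simp: p_def split: if_splits)
  qed
  also have "\<dots> = (\<Sum>i\<in>F. \<Sum>j\<in>F. p i j * ((norm (f i))\<^sup>2 / 2))
      + (\<Sum>i\<in>F. \<Sum>j\<in>F. p j i * ((norm (f j))\<^sup>2 / 2))"
    by (simp only: sum.distrib)
  also have "(\<Sum>i\<in>F. \<Sum>j\<in>F. p j i * ((norm (f j))\<^sup>2 / 2)) = (\<Sum>i\<in>F. \<Sum>j\<in>F. p i j * ((norm (f i))\<^sup>2 / 2))"
    by (rule sum.swap)
  also have "(\<Sum>i\<in>F. \<Sum>j\<in>F. p i j * ((norm (f i))\<^sup>2 / 2)) + (\<Sum>i\<in>F. \<Sum>j\<in>F. p i j * ((norm (f i))\<^sup>2 / 2))
      = (\<Sum>i\<in>F. (\<Sum>j\<in>F. p i j) * (norm (f i))\<^sup>2)"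
    by (simp only: sum.distrib[symmetric] sum_distrib_right distrib_left[symmetric] field_sum_of_halves)
  also have "\<dots> \<le> (\<Sum>i\<in>F. real C * (norm (f i))\<^sup>2)"
    by (intro sum_mono mult_right_mono row) auto
  finally show ?thesis
    by (simp add: sum_distrib_left)
qed

text \<open>The squared norms form a convergent series, so its tails are small, and the quadratic
  estimate carries this over to the vector sums. Absolute convergence is not asked for.\<close>

lemma summable_on_of_square_bound:
  fixes f :: "'i \<Rightarrow> 'a::chilbert_space"
  assumes quad: "\<And>F. finite F \<Longrightarrow> F \<subseteq> A \<Longrightarrow> (norm (sum f F))\<^sup>2 \<le> C * (\<Sum>i\<in>F. (norm (f i))\<^sup>2)"
    and bound: "\<And>F. finite F \<Longrightarrow> F \<subseteq> A \<Longrightarrow> (\<Sum>i\<in>F. (norm (f i))\<^sup>2) \<le> B"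
  shows "f summable_on A"
proof -
  define g where "g i = (norm (f i))\<^sup>2" for i
  \<comment> \<open>The sign of \<open>C\<close> is unknown; \<open>D\<close> dominates it and can
    be divided by.\<close>
  define D where "D = max C 1"
  have D: "D > 0" by (simp add: D_def)
  have quadD: "(norm (sum f F))\<^sup>2 \<le> D * sum g F" if "finite F" "F \<subseteq> A" for F
  proof -
    have "C * sum g F \<le> D * sum g F"
      by (intro mult_right_mono) (auto simp: D_def g_def sum_nonneg)
    with quad[OF that] show ?thesis
      unfolding g_def by linarith
  qed
  have "g summable_on A"
    using bound unfolding g_def by (intro nonneg_bdd_above_summable_on) (auto simp: bdd_above_def)
  then obtain L where L: "(sum g \<longlongrightarrow> L) (finite_subsets_at_top A)"
    unfolding summable_on_def has_sum_def by blast
  have "\<exists>P. eventually P (finite_subsets_at_top A) \<and>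
      (\<forall>F F'. P F \<and> P F' \<longrightarrow> dist (sum f F) (sum f F') < e)" if "e > 0" for e
  proof -
    \<comment> \<open>Two partial sums of \<open>g\<close> within \<open>d\<close> of
      \<open>L\<close> differ by less than \<open>2 * d\<close>, and \<open>D * (2 * d)\<close>
      equals \<open>(e / 2)\<^sup>2\<close>.\<close>
    define d where "d = e\<^sup>2 / (8 * D)"
    have d: "d > 0" using D that by (simp add: d_def)
    have "\<forall>\<^sub>F F in finite_subsets_at_top A. dist (sum g F) L < d"
      using L d by (rule tendstoD)
    then obtain X where X: "finite X" "X \<subseteq> A"
      and XL: "\<forall>F. finite F \<and> X \<subseteq> F \<and> F \<subseteq> A \<longrightarrow> dist (sum g F) L < d"
      unfolding eventually_finite_subsets_at_top by (elim exE conjE) rule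
    have small: "dist (sum f F) (sum f X) < e / 2" if F: "finite F" "X \<subseteq> F" "F \<subseteq> A" for F
    proof -
      have "sum g (F - X) = sum g F - sum g X"
        using F X by (simp add: sum_diff)
      also have "\<dots> < 2 * d"
        using XL[rule_format, of F] XL[rule_format, of X] F X by (simp add: dist_real_def)
      finally have "D * sum g (F - X) < D * (2 * d)"
        using D by simp
      then have "(norm (sum f (F - X)))\<^sup>2 < D * (2 * d)"
        using quadD[of "F - X"] F by (intro le_less_trans[OF quadD]) auto
      also have "\<dots> = (e / 2)\<^sup>2"
        using D by (simp add: d_def power2_eq_square)
      finally have "norm (sum f (F - X)) < e / 2"
        by (rule power_less_imp_less_base) (use \<open>e > 0\<close> in simp)
      then show ?thesis
        using F X by (simp add: sum_diff dist_norm)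
    qed
    show ?thesis
    proof (intro exI[of _ "\<lambda>F. finite F \<and> X \<subseteq> F \<and> F \<subseteq> A"] conjI allI impI)
      show "\<forall>\<^sub>F F in finite_subsets_at_top A. finite F \<and> X \<subseteq> F \<and> F \<subseteq> A"
        unfolding eventually_finite_subsets_at_top using X by blast
      fix F F'
      assume "(finite F \<and> X \<subseteq> F \<and> F \<subseteq> A) \<and> finite F' \<and> X \<subseteq> F' \<and> F' \<subseteq> A"
      then show "dist (sum f F) (sum f F') < e"
        using small[of F] small[of F'] dist_triangle2[of "sum f F" "sum f F'" "sum f X"] by linarith
    qed
  qed
  \<comment> \<open>The partial sums are indexed by finite sets rather than by numbers, so
    completeness is applied to a Cauchy filter.\<close>
  then have "cauchy_filter (filtermap (sum f) (finite_subsets_at_top A))"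
    by (simp add: cauchy_filter_metric_filtermap)
  moreover have "complete (UNIV::'a set)"
    by (meson Cauchy_convergent UNIV_I complete_def convergent_def)
  ultimately obtain S where "(sum f \<longlongrightarrow> S) (finite_subsets_at_top A)"
    using complete_uniform[where S=UNIV] by (force simp add: filterlim_def)
  then show ?thesis
    using summable_on_def has_sum_def by blast
qed

section \<open>Unitary operators with pure point spectrum\<close>

lemma clinear_scaleC: "clinear T \<Longrightarrow> T (c *\<^sub>C x) = c *\<^sub>C T x"
  unfolding Vector_Spaces.linear_iff by blast

lemma clinear_plus: "clinear T \<Longrightarrow> T (x + y) = T x + T y"
  unfolding Vector_Spaces.linear_iff by blast

lemma clinearI:
  assumes "\<And>x y. T (x + y) = T x + T y" "\<And>c x. T (c *\<^sub>C x) = c *\<^sub>C T x"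
  shows "clinear T"
  unfolding Vector_Spaces.linear_iff
  by (intro conjI allI assms complex_vector.vector_space_axioms)

lemma clinear_additive: "clinear T \<Longrightarrow> Modules.additive T"
  by (simp add: Modules.additive_def clinear_plus)

lemma unitary_clinear: "unitary U \<Longrightarrow> clinear U"
  and unitary_cinner: "unitary U \<Longrightarrow> cinner (U x) (U y) = cinner x y"
  unfolding unitary_def by auto

lemma unitary_norm: "unitary U \<Longrightarrow> norm (U x) = norm x"
  by (simp add: norm_eq_sqrt_cinner unitary_cinner)

lemma unitary_bij:
  assumes "unitary U"
  shows "bij U"
proof -
  have "inj U"
  proof (rule injI)
    fix x y assume eq: "U x = U y"
    have "U (x - y) = U x - U y"
      using Modules.additive.diff[OF clinear_additive[OF unitary_clinear[OF assms]]] .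
    then have "norm (x - y) = 0"
      using eq unitary_norm[OF assms, of "x - y"] by simp
    then show "x = y" by simp
  qed
  then show ?thesis
    using assms by (simp add: unitary_def bij_def)
qed

text \<open>Surjectivity and preservation of inner products make the inverse an adjoint, and
  adjoints are unique because the inner product separates vectors. This resolves the definite
  description in \<open>cadjoint\<close>.\<close>

lemma unitary_cadjoint:
  assumes "unitary U"
  shows "cadjoint U = inv U"
  unfolding cadjoint_def
proof (rule the_equality)
  have inv: "U (inv U y) = y" for y
    using unitary_bij[OF assms] by (simp add: bij_is_surj surj_f_inv_f)
  show adj: "is_cadjoint U (inv U)"
    unfolding is_cadjoint_def by (metis inv unitary_cinner[OF assms])
  fix S assume "is_cadjoint U S"
  with adj show "S = inv U"
    unfolding is_cadjoint_def by (metis cinner_eqI ext)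
qed

lemma eigenspace_iff: "x \<in> eigenspace T z \<longleftrightarrow> T x = z *\<^sub>C x"
  by (simp add: eigenspace_def)

lemma eigenvalue_cmod:
  assumes "unitary U" "z \<in> eigenvalues U"
  shows "cmod z = 1"
proof -
  obtain x where "x \<noteq> 0" "U x = z *\<^sub>C x"
    using assms(2) unfolding eigenvalues_def by auto
  then show ?thesis
    using unitary_norm[OF assms(1), of x] by (simp add: norm_scaleC_inner)
qed

text \<open>Unitarity yields \<open>cinner x y = v * cnj w * cinner x y\<close>. A nonzero value
  would make both vectors nonzero, hence \<open>v\<close> and \<open>w\<close> eigenvalues of
  modulus one, and then \<open>v * cnj w = 1\<close> means \<open>v = w\<close>.\<close>

lemma eigenspace_orthogonal:
  assumes "unitary U" "x \<in> eigenspace U v" "y \<in> eigenspace U w" "v \<noteq> w"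
  shows "cinner x y = 0"
proof (rule ccontr)
  assume nz: "cinner x y \<noteq> 0"
  then have "x \<noteq> 0" "y \<noteq> 0" by (auto simp: cinner.zero_left cinner.zero_right)
  then have v: "cmod v = 1" and w: "cmod w = 1"
    using assms by (auto intro!: eigenvalue_cmod[OF assms(1)] simp: eigenvalues_def eigenspace_def)
  have "cinner x y = v * cnj w * cinner x y"
    using unitary_cinner[OF assms(1), of x y] assms(2,3)
    by (simp add: eigenspace_def cinner_scaleC_left cinner_scaleC_right mult_ac)
  with nz have "v * cnj w = 1" by simp
  then have "v * (cnj w * w) = w"
    by (simp add: mult.assoc[symmetric])
  then have "v = w"
    using w by (simp add: mult.commute[of "cnj w"] complex_norm_square[symmetric])
  with assms(4) show False by simp
qed

lemma eigenspace_subspace: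
  assumes "clinear T"
  shows "complex_vector.subspace (eigenspace T z)"
  unfolding complex_vector.subspace_def
  using assms by (auto simp: eigenspace_def clinear_plus clinear_scaleC scaleC_add_right
      scaleC_scaleC mult.commute Modules.additive.zero[OF clinear_additive])

lemma bounded_linear_scaleC: "bounded_linear ((*\<^sub>C) c :: 'a::complex_inner \<Rightarrow> 'a)"
  by (rule bounded_linear_intro[of _ "cmod c"])
    (auto simp: scaleC_add_right scaleR_eq_scaleC scaleC_scaleC mult.commute norm_scaleC_inner)

lemma bounded_linear_of_clinear:
  assumes "clinear T" "\<And>x. norm (T x) \<le> K * norm x"
  shows "bounded_linear T"
  by (rule bounded_linear_intro[of _ K])
    (auto simp: assms clinear_plus clinear_scaleC scaleR_eq_scaleC mult.commute[of _ K])

lemma closed_eigenspace: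
  assumes "unitary U"
  shows "closed (eigenspace U z)"
proof -
  have "bounded_linear U"
    using bounded_linear_of_clinear[of U 1] assms
    by (simp add: unitary_clinear unitary_norm)
  then show ?thesis
    unfolding eigenspace_def
    by (intro closed_Collect_eq linear_continuous_on bounded_linear_scaleC)
qed

text \<open>Compactness as an induction principle: a property that defines a closed subspace need
  only be checked on eigenvectors. All density arguments below go through it.\<close>

lemma compact_system_induct:
  assumes "compact_system U" "complex_vector.subspace S" "closed S"
    and "\<And>x z. z \<in> eigenvalues U \<Longrightarrow> x \<in> eigenspace U z \<Longrightarrow> x \<in> S"
  shows "x \<in> S"
proof -
  have "eigenvectors U \<subseteq> S"
    using assms(4) by (auto simp: eigenvectors_def eigenspace_def eigenvalues_def)
  then have "complex_vector.span (eigenvectors U) \<subseteq> S"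
    using assms(2) by (rule complex_vector.span_minimal)
  then have "closure (complex_vector.span (eigenvectors U)) \<subseteq> S"
    using assms(3) by (rule closure_minimal)
  with assms(1) show ?thesis
    by (auto simp: compact_system_def)
qed

section \<open>Eigenprojections and Bessel's inequality\<close>

locale pure_point_unitary =
  fixes U :: "'h::chilbert_space \<Rightarrow> 'h"
  assumes unitary: "unitary U" and compact: "compact_system U"
begin

text \<open>The vectors having an orthogonal projection form a closed subspace, so density of the span of
  the eigenvectors makes the general projection theorem unnecessary.\<close>

lemma eigenproj_exists:
  "\<exists>y\<in>eigenspace U z. \<forall>m\<in>eigenspace U z. cinner (x - y) m = 0"
proof -
  let ?M = "eigenspace U z"
  note sub = eigenspace_subspace[OF unitary_clinear[OF unitary], of z]
  define S where "S = {x. \<exists>y\<in>?M. \<forall>m\<in>?M. cinner (x - y) m = 0}"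
  have "x \<in> S"
  proof (rule compact_system_induct[OF compact])
    show "complex_vector.subspace S"
      unfolding complex_vector.subspace_def
    proof (intro conjI ballI allI)
      show "0 \<in> S"
        unfolding S_def using complex_vector.subspace_0[OF sub]
        by (auto simp: cinner.zero_left intro!: bexI[of _ 0])
      fix u v assume "u \<in> S" "v \<in> S"
      then obtain a b where "a \<in> ?M" "b \<in> ?M" "\<forall>m\<in>?M. cinner (u - a) m = 0" "\<forall>m\<in>?M. cinner (v - b) m = 0"
        unfolding S_def by auto
      then have "a + b \<in> ?M" "\<forall>m\<in>?M. cinner (u + v - (a + b)) m = 0"
        by (auto intro: complex_vector.subspace_add[OF sub] simp: cinner.diff_left cinner_add_left)
      then show "u + v \<in> S"
        unfolding S_def by blast
    next
      fix u c assume "u \<in> S"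
      then obtain a where "a \<in> ?M" "\<forall>m\<in>?M. cinner (u - a) m = 0"
        unfolding S_def by auto
      then have "c *\<^sub>C a \<in> ?M" "\<forall>m\<in>?M. cinner (c *\<^sub>C u - c *\<^sub>C a) m = 0"
        by (auto intro: complex_vector.subspace_scale[OF sub] simp: cinner.diff_left cinner_scaleC_left)
      then show "c *\<^sub>C u \<in> S"
        unfolding S_def by blast
    qed
    show "closed S"
      unfolding closed_sequential_limits
    proof (intro allI impI, elim conjE)
      fix u l assume "\<forall>n. u n \<in> S" and lim: "u \<longlonglongrightarrow> l"
      then have "\<forall>n. \<exists>y. y \<in> ?M \<and> (\<forall>m\<in>?M. cinner (u n - y) m = 0)"
        unfolding S_def by auto
      then obtain y where y: "\<And>n. y n \<in> ?M" and orth: "\<And>n m. m \<in> ?M \<Longrightarrow> cinner (u n - y n) m = 0"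
        by metis
      \<comment> \<open>The residuals are orthogonal to the eigenspace, so by Pythagoras projecting
        does not increase distances. Thus the projections of a convergent sequence are Cauchy, and
        their limit is the candidate for \<open>l\<close>.\<close>
      have contr: "dist (y m) (y n) \<le> dist (u m) (u n)" for m n
      proof -
        let ?r = "(u m - y m) - (u n - y n)"
        have "cinner ?r (y m - y n) = 0"
          using orth complex_vector.subspace_diff[OF sub y y] by (simp add: cinner.diff_left)
        then have "(norm (?r + (y m - y n)))\<^sup>2 = (norm ?r)\<^sup>2 + (norm (y m - y n))\<^sup>2"
          by (rule norm_add_square_orthogonal)
        moreover have "?r + (y m - y n) = u m - u n" by simp
        ultimately have "(norm (y m - y n))\<^sup>2 \<le> (norm (u m - u n))\<^sup>2" by simp
        then show ?thesis
          unfolding dist_norm by (rule power2_le_imp_le) simp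
      qed
      have "Cauchy u"
        using lim by (rule LIMSEQ_imp_Cauchy)
      then have "Cauchy y"
        unfolding Cauchy_def using contr by (meson le_less_trans)
      then obtain l' where l': "y \<longlonglongrightarrow> l'"
        using Cauchy_convergent convergent_def by blast
      have "l' \<in> ?M"
        using closed_eigenspace[OF unitary] y l' by (rule closed_sequentially)
      moreover have "cinner (l - l') m = 0" if "m \<in> ?M" for m
      proof (rule LIMSEQ_unique)
        show "(\<lambda>n. cinner (u n - y n) m) \<longlonglongrightarrow> cinner (l - l') m"
          by (intro cinner.tendsto tendsto_diff lim l' tendsto_const)
        show "(\<lambda>n. cinner (u n - y n) m) \<longlonglongrightarrow> 0"
          using orth[OF that] by simp
      qed
      ultimately show "l \<in> S"
        unfolding S_def by blast
    qed
    fix u w assume u: "u \<in> eigenspace U w"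
    show "u \<in> S"
    proof (cases "w = z")
      case True
      with u show ?thesis
        unfolding S_def by (auto simp: cinner.zero_left intro!: bexI[of _ u])
    next
      case False
      with u show ?thesis
        unfolding S_def using complex_vector.subspace_0[OF sub]
        by (auto intro!: bexI[of _ 0] eigenspace_orthogonal[OF unitary])
    qed
  qed
  then show ?thesis
    unfolding S_def by simp
qed

text \<open>Two candidates differ by a vector of the eigenspace that is orthogonal to itself. Every
  later evaluation of a projection rests on this rule.\<close>

lemma eigenproj_eqI:
  assumes "y \<in> eigenspace U z" "\<And>m. m \<in> eigenspace U z \<Longrightarrow> cinner (x - y) m = 0"
  shows "eigenproj U z x = y"
  unfolding orth_proj_def
proof (rule the_equality)
  fix y' assume y': "y' \<in> eigenspace U z \<and> (\<forall>m\<in>eigenspace U z. cinner (x - y') m = 0)"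
  have m: "y - y' \<in> eigenspace U z"
    using assms(1) y' eigenspace_subspace[OF unitary_clinear[OF unitary]]
    by (simp add: complex_vector.subspace_diff)
  have "cinner (x - y') (y - y') - cinner (x - y) (y - y') = 0"
    using assms(2)[OF m] y' m by simp
  then have "cinner (y - y') (y - y') = 0"
    by (simp add: cinner.diff_left)
  then show "y' = y"
    by (simp add: cinner_eq_zero_iff)
qed (use assms in auto)

lemma eigenproj_mem: "eigenproj U z x \<in> eigenspace U z"
  and eigenproj_cinner: "m \<in> eigenspace U z \<Longrightarrow> cinner (eigenproj U z x) m = cinner x m"
proof -
  obtain y where y: "y \<in> eigenspace U z" "\<And>m. m \<in> eigenspace U z \<Longrightarrow> cinner (x - y) m = 0"
    using eigenproj_exists by blast
  then have eq: "eigenproj U z x = y"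
    by (rule eigenproj_eqI)
  show "eigenproj U z x \<in> eigenspace U z"
    using y(1) by (simp only: eq)
  assume "m \<in> eigenspace U z"
  then show "cinner (eigenproj U z x) m = cinner x m"
    using y(2)[of m] by (simp add: eq cinner.diff_left)
qed

lemma eigenproj_eigenvector:
  assumes "x \<in> eigenspace U w"
  shows "eigenproj U z x = (if z = w then x else 0)"
  using assms complex_vector.subspace_0[OF eigenspace_subspace[OF unitary_clinear[OF unitary]]]
  by (intro eigenproj_eqI) (auto simp: cinner.zero_left intro: eigenspace_orthogonal[OF unitary])

lemma clinear_eigenproj: "clinear (eigenproj U z)"
proof (rule clinearI)
  note sub = eigenspace_subspace[OF unitary_clinear[OF unitary], of z]
  show "eigenproj U z (x + y) = eigenproj U z x + eigenproj U z y" for x y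
    by (intro eigenproj_eqI complex_vector.subspace_add[OF sub] eigenproj_mem)
      (simp add: cinner.diff_left cinner_add_left eigenproj_cinner)
  show "eigenproj U z (c *\<^sub>C x) = c *\<^sub>C eigenproj U z x" for c x
    by (intro eigenproj_eqI complex_vector.subspace_scale[OF sub] eigenproj_mem)
      (simp add: cinner.diff_left cinner_scaleC_left eigenproj_cinner)
qed

lemma eigenproj_orthogonal:
  "v \<noteq> w \<Longrightarrow> cinner (eigenproj U v x) (eigenproj U w y) = 0"
  by (rule eigenspace_orthogonal[OF unitary eigenproj_mem eigenproj_mem])

lemma eigenproj_bessel:
  assumes "finite W"
  shows "(\<Sum>w\<in>W. (norm (eigenproj U w x))\<^sup>2) \<le> (norm x)\<^sup>2"
proof -
  define s where "s = (\<Sum>w\<in>W. eigenproj U w x)"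
  \<comment> \<open>Pairing \<open>s\<close> with one component leaves the diagonal term only, which
    equals the pairing of \<open>x\<close> with that component.\<close>
  have "cinner (x - s) (eigenproj U v x) = 0" if "v \<in> W" for v
  proof -
    have "cinner s (eigenproj U v x) = (\<Sum>w\<in>W. if w = v then cinner (eigenproj U v x) (eigenproj U v x) else 0)"
      unfolding s_def cinner.sum_left by (intro sum.cong) (auto simp: eigenproj_orthogonal)
    also have "\<dots> = cinner x (eigenproj U v x)"
      using assms that by (simp add: eigenproj_cinner eigenproj_mem)
    finally show ?thesis
      by (simp add: cinner.diff_left)
  qed
  then have "cinner (x - s) s = 0"
    by (subst (2) s_def) (simp add: cinner.sum_right)
  from norm_add_square_orthogonal[OF this] have "(norm s)\<^sup>2 \<le> (norm x)\<^sup>2"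
    by simp
  moreover have "(norm s)\<^sup>2 = (\<Sum>w\<in>W. (norm (eigenproj U w x))\<^sup>2)"
    unfolding s_def by (rule norm_sum_square_orthogonal[OF assms]) (rule eigenproj_orthogonal)
  ultimately show ?thesis by simp
qed

lemma norm_eigenproj_le: "norm (eigenproj U z x) \<le> norm x"
  using eigenproj_bessel[of "{z}" x] by (intro power2_le_imp_le[OF _ norm_ge_zero]) simp

end


section \<open>Resonant sums\<close>

text \<open>The source of the multiplicity bounds: with one entry of a resonant pair fixed, the
  other solves such an equation. A negative exponent is reduced to a positive one by inverting
  \<open>c\<close>.\<close>

lemma powi_roots:
  fixes c :: complex
  assumes "c \<noteq> 0" "k \<noteq> 0"
  shows "finite {z. z powi k = c}" and "card {z. z powi k = c} = nat \<bar>k\<bar>"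
proof -
  have "{z. z powi k = c} = (if k > 0 then {z. z ^ nat k = c} else {z. z ^ nat (- k) = inverse c})"
    using assms(2) by (auto simp: power_int_def power_inverse)
  then show "finite {z. z powi k = c}" "card {z. z powi k = c} = nat \<bar>k\<bar>"
    using assms by (auto simp: finite_nth_roots card_nth_roots)
qed

lemma cesaro_powers:
  fixes z :: complex
  assumes "cmod z = 1"
  shows "(\<lambda>N. 1 / of_nat N * (\<Sum>n<N. z ^ n)) \<longlonglongrightarrow> (if z = 1 then 1 else 0)"
proof (cases "z = 1")
  case True
  \<comment> \<open>At \<open>N = 0\<close> the expression is 0, so the equality holds only
    eventually.\<close>
  have "\<forall>\<^sub>F N in sequentially. 1 / of_nat N * (\<Sum>n<N. z ^ n) = 1"
    using eventually_gt_at_top[of 0] by eventually_elim (simp add: True)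
  with True show ?thesis
    by (simp add: tendsto_eventually)
next
  case False
  \<comment> \<open>Away from \<open>z = 1\<close> the geometric sum stays bounded by
    \<open>2 / cmod (z - 1)\<close>, and the factor \<open>1 / N\<close> drives the mean to
    zero.\<close>
  have bound: "cmod (1 / of_nat N * (\<Sum>n<N. z ^ n)) \<le> 2 / cmod (z - 1) * (1 / real N)" for N
  proof -
    have "cmod (z ^ N - 1) \<le> cmod (z ^ N) + cmod 1"
      by (rule norm_triangle_ineq4)
    then have "cmod (z ^ N - 1) \<le> 2"
      using assms by (simp add: norm_power)
    moreover have "1 / of_nat N * (\<Sum>n<N. z ^ n) = (z ^ N - 1) / (z - 1) * (1 / of_nat N)"
      using False by (simp add: geometric_sum)
    ultimately show ?thesis
      by (simp only: norm_mult norm_divide norm_of_nat norm_one)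
        (intro mult_right_mono divide_right_mono, auto)
  qed
  have "(\<lambda>N. 2 / cmod (z - 1) * (1 / real N)) \<longlonglongrightarrow> 2 / cmod (z - 1) * 0"
    by (intro tendsto_mult tendsto_const lim_1_over_n)
  then have "(\<lambda>N. 2 / cmod (z - 1) * (1 / real N)) \<longlonglongrightarrow> 0"
    by (simp only: mult_zero_right)
  then have "(\<lambda>N. 1 / of_nat N * (\<Sum>n<N. z ^ n)) \<longlonglongrightarrow> 0"
    by (rule Lim_null_comparison[OF always_eventually[OF allI[OF bound]]])
  with False show ?thesis by (simp only: if_False)
qed

text \<open>The Lipschitz constant is the same for all \<open>N\<close>, so an approximating point
  can be chosen before \<open>N\<close>. Inside, \<open>D\<close> is a positive majorant of
  \<open>K\<close>.\<close>

lemma closed_tendsto_zero: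
  fixes g :: "nat \<Rightarrow> 'a::real_normed_vector \<Rightarrow> complex"
  assumes "\<And>N x y. cmod (g N x - g N y) \<le> K * norm (x - y)"
  shows "closed {x. (\<lambda>N. g N x) \<longlonglongrightarrow> 0}"
  unfolding closed_sequential_limits
proof (intro allI impI, elim conjE, unfold mem_Collect_eq)
  fix u l assume u: "\<forall>n. (\<lambda>N. g N (u n)) \<longlonglongrightarrow> 0" and lim: "u \<longlonglongrightarrow> l"
  show "(\<lambda>N. g N l) \<longlonglongrightarrow> 0"
  proof (rule tendstoI)
    fix e :: real assume e: "e > 0"
    define D where "D = max K 0 + 1"
    have D: "D > 0" by (simp add: D_def)
    obtain n where n: "dist (u n) l < e / (2 * D)"
      using lim e D by (metis LIMSEQ_def divide_pos_pos mult_pos_pos zero_less_numeral order_refl)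
    have close: "cmod (g N l - g N (u n)) < e / 2" for N
    proof -
      have "cmod (g N l - g N (u n)) \<le> D * norm (l - u n)"
        by (rule order_trans[OF assms mult_right_mono]) (auto simp: D_def)
      also have "\<dots> < D * (e / (2 * D))"
        using n D by (intro mult_strict_left_mono) (simp_all add: dist_norm norm_minus_commute)
      finally show ?thesis using D by simp
    qed
    have "\<forall>\<^sub>F N in sequentially. dist (g N (u n)) 0 < e / 2"
      using u e by (intro tendstoD) auto
    then show "\<forall>\<^sub>F N in sequentially. dist (g N l) 0 < e"
    proof eventually_elim
      case (elim N)
      then show ?case
        using close[of N] norm_triangle_ineq[of "g N l - g N (u n)" "g N (u n)"] by simp
    qed
  qed
qed

section \<open>Convergence and boundedness of the resonant series\<close>

locale resonance = pure_point_unitary U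
  for U :: "'h::chilbert_space \<Rightarrow> 'h" +
  fixes k\<^sub>1 k\<^sub>2 :: int and A :: "'h \<Rightarrow> 'h" and K :: real
  assumes k\<^sub>1: "k\<^sub>1 \<noteq> 0" and k\<^sub>1_k\<^sub>2: "k\<^sub>1 \<noteq> k\<^sub>2"
    and linear: "clinear A" and bound: "norm (A x) \<le> K * norm x"
begin

definition block :: "'h \<Rightarrow> complex \<times> complex \<Rightarrow> 'h"
  where "block x p = eigenproj U (fst p) (A (eigenproj U (snd p) x))"

abbreviation "S \<equiv> resonant_sum k\<^sub>1 k\<^sub>2 U A"
abbreviation "R \<equiv> resonant_pairs k\<^sub>1 k\<^sub>2 U"

lemma S_eq: "S x = infsum (block x) R"
  unfolding resonant_sum_def
  by (rule arg_cong[of _ _ "\<lambda>f. infsum f R"]) (auto simp: block_def)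

lemma resonant_pairs_nonzero:
  assumes "p \<in> R"
  shows "fst p \<noteq> 0" "snd p \<noteq> 0"
  using assms by (auto simp: resonant_pairs_def dest: eigenvalue_cmod[OF unitary])

text \<open>For fixed \<open>v\<close> the second entry is a root of an equation of degree
  \<open>\<bar>k\<^sub>2 - k\<^sub>1\<bar>\<close>, nonzero because the exponents differ. The
  equation can be solved for \<open>w\<close> only if \<open>v\<close> is invertible;
  \<open>v = 0\<close> is no eigenvalue and has an empty fibre.\<close>

lemma card_resonant_left:
  assumes "finite F" "F \<subseteq> R"
  shows "card {p\<in>F. fst p = v} \<le> nat \<bar>k\<^sub>2 - k\<^sub>1\<bar>"
proof (cases "v = 0")
  case True
  then have "{p\<in>F. fst p = v} = {}"
    by (auto dest!: subsetD[OF assms(2)] resonant_pairs_nonzero(1))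
  then show ?thesis by (simp only: card.empty le0)
next
  case False
  let ?B = "{w. w powi (k\<^sub>2 - k\<^sub>1) = inverse (v powi k\<^sub>1)}"
  have B: "finite ?B" "card ?B = nat \<bar>k\<^sub>2 - k\<^sub>1\<bar>"
    using False k\<^sub>1_k\<^sub>2 by (intro powi_roots; simp)+
  have "{p\<in>F. fst p = v} \<subseteq> Pair v ` ?B"
    using assms(2) False by (auto simp: resonant_pairs_def field_simps)
  then have "card {p\<in>F. fst p = v} \<le> card (Pair v ` ?B)"
    using B by (intro card_mono) auto
  also have "\<dots> \<le> card ?B"
    using B by (intro card_image_le)
  finally show ?thesis using B by simp
qed

text \<open>The mirror image: fixing \<open>w\<close> leaves an equation for \<open>v\<close> with
  exponent \<open>k\<^sub>1\<close>, and \<open>k\<^sub>1 \<noteq> 0\<close> makes its solution set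
  finite.\<close>

lemma card_resonant_right:
  assumes "finite F" "F \<subseteq> R"
  shows "card {p\<in>F. snd p = w} \<le> nat \<bar>k\<^sub>1\<bar>"
proof (cases "w = 0")
  case True
  then have "{p\<in>F. snd p = w} = {}"
    by (auto dest!: subsetD[OF assms(2)] resonant_pairs_nonzero(2))
  then show ?thesis by (simp only: card.empty le0)
next
  case False
  let ?B = "{v. v powi k\<^sub>1 = inverse (w powi (k\<^sub>2 - k\<^sub>1))}"
  have B: "finite ?B" "card ?B = nat \<bar>k\<^sub>1\<bar>"
    using False k\<^sub>1 by (intro powi_roots; simp)+
  have "{p\<in>F. snd p = w} \<subseteq> (\<lambda>v. (v, w)) ` ?B"
    using assms(2) False by (auto simp: resonant_pairs_def field_simps)
  then have "card {p\<in>F. snd p = w} \<le> card ((\<lambda>v. (v, w)) ` ?B)"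
    using B by (intro card_mono) auto
  also have "\<dots> \<le> card ?B"
    using B by (intro card_image_le)
  finally show ?thesis using B by simp
qed

text \<open>Each block is at most \<open>K\<close> times the \<open>w\<close>-component of
  \<open>x\<close>. A given \<open>w\<close> occurs at most \<open>\<bar>k\<^sub>1\<bar>\<close>
  times, and Bessel bounds the sum over distinct \<open>w\<close>.\<close>

lemma sum_norm_block_square_le:
  assumes "finite F" "F \<subseteq> R"
  shows "(\<Sum>p\<in>F. (norm (block x p))\<^sup>2) \<le> real (nat \<bar>k\<^sub>1\<bar>) * (K * norm x)\<^sup>2"
proof -
  let ?e = "\<lambda>w. (norm (eigenproj U w x))\<^sup>2"
  have "(\<Sum>p\<in>F. (norm (block x p))\<^sup>2) \<le> (\<Sum>p\<in>F. K\<^sup>2 * ?e (snd p))"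
  proof (rule sum_mono)
    fix p
    have "norm (block x p) \<le> K * norm (eigenproj U (snd p) x)"
      unfolding block_def by (rule order_trans[OF norm_eigenproj_le bound])
    then show "(norm (block x p))\<^sup>2 \<le> K\<^sup>2 * ?e (snd p)"
      unfolding power_mult_distrib[symmetric] by (rule power_mono) simp
  qed
  also have "\<dots> = K\<^sup>2 * (\<Sum>p\<in>F. ?e (snd p))"
    by (simp add: sum_distrib_left)
  \<comment> \<open>The pairs are grouped by second entry, so multiplicities appear as fibre
    cardinalities.\<close>
  also have "(\<Sum>p\<in>F. ?e (snd p)) = (\<Sum>w\<in>snd ` F. real (card {p\<in>F. snd p = w}) * ?e w)"
    by (subst sum.image_gen[OF assms(1), of _ snd]) simp
  also have "K\<^sup>2 * \<dots> \<le> K\<^sup>2 * (\<Sum>w\<in>snd ` F. real (nat \<bar>k\<^sub>1\<bar>) * ?e w)"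
    by (intro mult_left_mono sum_mono mult_right_mono of_nat_mono card_resonant_right[OF assms]) auto
  also have "\<dots> = K\<^sup>2 * (real (nat \<bar>k\<^sub>1\<bar>) * (\<Sum>w\<in>snd ` F. ?e w))"
    by (simp add: sum_distrib_left)
  also have "\<dots> \<le> K\<^sup>2 * (real (nat \<bar>k\<^sub>1\<bar>) * (norm x)\<^sup>2)"
    using assms(1) by (intro mult_left_mono eigenproj_bessel) auto
  finally show ?thesis
    by (simp add: power_mult_distrib mult_ac)
qed

text \<open>Blocks with different first indices are orthogonal, and a first index occurs in at most
  \<open>\<bar>k\<^sub>2 - k\<^sub>1\<bar>\<close> resonant pairs.\<close>

lemma norm_sum_block_square_le:
  assumes "finite F" "F \<subseteq> R"
  shows "(norm (sum (block x) F))\<^sup>2 \<le> real (nat \<bar>k\<^sub>2 - k\<^sub>1\<bar>) * (\<Sum>p\<in>F. (norm (block x p))\<^sup>2)"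
proof (rule norm_sum_square_le_almost_orthogonal[OF assms(1)])
  fix p
  have "fst q = fst p" if "cinner (block x p) (block x q) \<noteq> 0" for q
  proof (rule ccontr)
    assume "fst q \<noteq> fst p"
    then have "cinner (block x p) (block x q) = 0"
      unfolding block_def by (intro eigenproj_orthogonal) simp
    with that show False by simp
  qed
  then have "{q\<in>F. cinner (block x p) (block x q) \<noteq> 0} \<subseteq> {q\<in>F. fst q = fst p}"
    by auto
  then have "card {q\<in>F. cinner (block x p) (block x q) \<noteq> 0} \<le> card {q\<in>F. fst q = fst p}"
    using assms(1) by (intro card_mono) auto
  also have "\<dots> \<le> nat \<bar>k\<^sub>2 - k\<^sub>1\<bar>"
    by (rule card_resonant_left[OF assms])
  finally show "card {q\<in>F. cinner (block x p) (block x q) \<noteq> 0} \<le> nat \<bar>k\<^sub>2 - k\<^sub>1\<bar>" .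
qed

text \<open>\<open>infsum\<close> defaults to 0 when there is no sum, so this is what gives
  \<open>resonant_sum\<close> its meaning. The two square estimates are the premises of the
  summability criterion.\<close>

lemma block_has_sum: "(block x has_sum S x) R"
  unfolding S_eq
  by (rule has_sum_infsum,
      rule summable_on_of_square_bound[OF norm_sum_block_square_le sum_norm_block_square_le])

text \<open>The constant obtained by chaining the two square estimates and taking a root; the
  absolute value keeps it nonnegative for any sign of \<open>K\<close>.\<close>

definition L :: real
  where "L = sqrt (real (nat \<bar>k\<^sub>2 - k\<^sub>1\<bar>) * real (nat \<bar>k\<^sub>1\<bar>)) * \<bar>K\<bar>"

lemma norm_S_le: "norm (S x) \<le> L * norm x"
proof (rule tendsto_upperbound)
  show "((\<lambda>F. norm (sum (block x) F)) \<longlongrightarrow> norm (S x)) (finite_subsets_at_top R)"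
    using block_has_sum[of x] unfolding has_sum_def by (rule tendsto_norm)
  show "\<forall>\<^sub>F F in finite_subsets_at_top R. norm (sum (block x) F) \<le> L * norm x"
  proof (rule eventually_finite_subsets_at_top_weakI)
    fix F assume F: "finite F" "F \<subseteq> R"
    have "(norm (sum (block x) F))\<^sup>2 \<le> real (nat \<bar>k\<^sub>2 - k\<^sub>1\<bar>) * (real (nat \<bar>k\<^sub>1\<bar>) * (K * norm x)\<^sup>2)"
      using F by (intro order_trans[OF norm_sum_block_square_le] mult_left_mono sum_norm_block_square_le) auto
    also have "\<dots> = (L * norm x)\<^sup>2"
      by (simp add: L_def power_mult_distrib mult_ac)
    finally show "norm (sum (block x) F) \<le> L * norm x"
      by (rule power2_le_imp_le) (simp add: L_def)
  qed
  show "finite_subsets_at_top R \<noteq> bot" by simp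
qed

lemma clinear_S: "clinear S"
proof (rule clinearI)
  fix x y c
  have "((\<lambda>p. block x p + block y p) has_sum S x + S y) R"
    by (intro has_sum_add block_has_sum)
  moreover have "(\<lambda>p. block x p + block y p) = block (x + y)"
    by (simp add: fun_eq_iff block_def clinear_plus clinear_eigenproj linear)
  ultimately show "S (x + y) = S x + S y"
    using block_has_sum[of "x + y"] has_sum_unique by metis
  have "((*\<^sub>C) c \<circ> block x has_sum c *\<^sub>C S x) R"
    by (intro has_sum_comm_additive block_has_sum)
      (auto simp: Modules.additive_def scaleC_add_right intro!: isContD
        linear_continuous_at bounded_linear_scaleC)
  moreover have "(*\<^sub>C) c \<circ> block x = block (c *\<^sub>C x)"
    by (simp add: fun_eq_iff block_def clinear_scaleC clinear_eigenproj linear)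
  ultimately show "S (c *\<^sub>C x) = c *\<^sub>C S x"
    using block_has_sum[of "c *\<^sub>C x"] has_sum_unique by metis
qed

text \<open>Against eigenvectors the series collapses to the block \<open>(v, w)\<close>: a
  different first index gives a vector orthogonal to \<open>y\<close>, and a different second index
  annihilates \<open>x\<close>.\<close>

lemma cinner_S_eigenvectors:
  assumes "v \<in> eigenvalues U" "w \<in> eigenvalues U" "x \<in> eigenspace U w" "y \<in> eigenspace U v"
  shows "cinner (S x) y = (if v powi k\<^sub>1 * w powi (k\<^sub>2 - k\<^sub>1) = 1 then cinner (A x) y else 0)"
proof -
  have "((\<lambda>u. cinner u y) \<circ> block x has_sum cinner (S x) y) R"
    by (intro has_sum_comm_additive block_has_sum)
      (auto simp: Modules.additive_def cinner_add_left intro!: isContD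
        linear_continuous_at cinner.bounded_linear_left)
  moreover have "((\<lambda>u. cinner u y) \<circ> block x) p = (if p = (v, w) then cinner (A x) y else 0)" for p
  proof (cases "p = (v, w)")
    case True
    then show ?thesis
      using assms by (simp add: block_def eigenproj_eigenvector eigenproj_cinner)
  next
    case False
    then consider "fst p \<noteq> v" | "snd p \<noteq> w" by (cases p) auto
    then have "cinner (block x p) y = 0"
    proof cases
      case 1
      show ?thesis
        unfolding block_def by (rule eigenspace_orthogonal[OF unitary eigenproj_mem assms(4) 1])
    next
      case 2
      have "A 0 = 0" "eigenproj U (fst p) 0 = 0"
        using linear clinear_eigenproj by (auto simp: Modules.additive.zero clinear_additive)
      with 2 assms show ?thesis
        by (simp add: block_def eigenproj_eigenvector cinner.zero_left)
    qed
    with False show ?thesis by simp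
  qed
  ultimately have sum: "((\<lambda>p. if p = (v, w) then cinner (A x) y else 0) has_sum cinner (S x) y) R"
    by (simp add: comp_def)
  \<comment> \<open>Intersecting with the singleton treats resonant and nonresonant pairs at once:
    the index set is then a point or empty.\<close>
  have "((\<lambda>p. if p = (v, w) then cinner (A x) y else 0) has_sum
      (if (v, w) \<in> R then cinner (A x) y else 0)) (R \<inter> {(v, w)})"
    by (intro has_sum_finiteI) auto
  then have "((\<lambda>p. if p = (v, w) then cinner (A x) y else 0) has_sum
      (if (v, w) \<in> R then cinner (A x) y else 0)) R"
    by (rule has_sum_cong_neutral[THEN iffD1, rotated -1]) auto
  with sum show ?thesis
    using assms(1,2) by (auto dest: has_sum_unique simp: resonant_pairs_def)
qed

end

section \<open>Averages\<close>

lemma unitary_id: "unitary id"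
  unfolding unitary_def by (auto intro: clinearI)

lemma unitary_comp:
  assumes "unitary U" "unitary V"
  shows "unitary (U \<circ> V)"
  using assms comp_surj[of V U] unfolding unitary_def
  by (intro conjI clinearI) (simp_all add: clinear_plus clinear_scaleC)

lemma unitary_inv:
  assumes "unitary U"
  shows "unitary (inv U)"
proof -
  have bij: "bij U" by (rule unitary_bij[OF assms])
  have U_inv: "U (inv U x) = x" for x
    using bij by (simp add: bij_is_surj surj_f_inv_f)
  have inv_eq: "inv U x = y" if "U y = x" for x y
    using bij that by (metis bij_is_inj inv_f_f)
  show ?thesis
    unfolding unitary_def
  proof (intro conjI allI clinearI)
    show "inv U (x + y) = inv U x + inv U y" for x y
      by (rule inv_eq) (simp add: clinear_plus[OF unitary_clinear[OF assms]] U_inv)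
    show "inv U (c *\<^sub>C x) = c *\<^sub>C inv U x" for c x
      by (rule inv_eq) (simp add: clinear_scaleC[OF unitary_clinear[OF assms]] U_inv)
    show "surj (inv U)"
      using bij by (simp add: bij_imp_bij_inv bij_is_surj)
    show "cinner (inv U x) (inv U y) = cinner x y" for x y
      by (metis U_inv unitary_cinner[OF assms])
  qed
qed

lemma unitary_funpow_int:
  assumes "unitary U"
  shows "unitary (funpow_int U k)"
proof -
  have "unitary (V ^^ n)" if "unitary V" for V :: "'a \<Rightarrow> 'a" and n
    by (induction n) (simp_all only: funpow.simps unitary_id unitary_comp[OF that])
  then show ?thesis
    using assms unitary_inv[OF assms] by (simp add: funpow_int_def)
qed

lemma funpow_int_Suc:
  assumes "bij f"
  shows "funpow_int f (k + 1) x = f (funpow_int f k x)"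
proof (cases "k \<ge> 0")
  case True
  then show ?thesis by (simp add: funpow_int_def nat_add_distrib)
next
  case False
  then have "nat (- k) = Suc (nat (- (k + 1)))" by simp
  moreover have "f (inv f y) = y" for y
    using assms by (simp add: bij_is_surj surj_f_inv_f)
  ultimately have "f (funpow_int f k x) = (inv f ^^ nat (- (k + 1))) x"
    using False by (simp add: funpow_int_def)
  \<comment> \<open>For \<open>k = - 1\<close> the right side passes to the nonnegative branch of
    \<open>funpow_int\<close>; both sides are then \<open>x\<close>.\<close>
  also have "\<dots> = funpow_int f (k + 1) x"
    using False by (cases "k = - 1") (simp_all add: funpow_int_def)
  finally show ?thesis ..
qed

lemma funpow_int_add:
  assumes "bij f"
  shows "funpow_int f (j + k) x = funpow_int f j (funpow_int f k x)"
proof (induction j rule: int_induct[where k = 0])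
  case base
  show ?case by (simp add: funpow_int_def)
next
  case (step1 i)
  then show ?case
    using funpow_int_Suc[OF assms, of "i + k" x] funpow_int_Suc[OF assms, of i "funpow_int f k x"]
    by (simp add: algebra_simps)
next
  case (step2 i)
  \<comment> \<open>The downward step is proved after applying \<open>f\<close>, which is then
    cancelled by injectivity.\<close>
  have "f (funpow_int f (i - 1 + k) x) = f (funpow_int f (i - 1) (funpow_int f k x))"
    using step2 funpow_int_Suc[OF assms, of "i - 1 + k" x]
      funpow_int_Suc[OF assms, of "i - 1" "funpow_int f k x"]
    by (simp add: algebra_simps)
  then show ?case
    using assms by (simp add: bij_is_inj inj_eq)
qed

text \<open>Covariance in abstract form, meant for \<open>F\<close> a representation. The
  intertwining relation passes to the inverses, so both branches of \<open>funpow_int\<close> follow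
  by induction.\<close>

lemma funpow_int_covariant:
  assumes "bij f" "bij g" and cov: "\<And>a x. F (f a) (g x) = g (F a x)"
  shows "F (funpow_int f k a) (funpow_int g k x) = funpow_int g k (F a x)"
proof -
  have inv: "F (inv f a) (inv g x) = inv g (F a x)" for a x
    using cov[of "inv f a" "inv g x"] assms(1,2)
    by (metis bij_is_inj bij_is_surj inv_f_f surj_f_inv_f)
  have "F ((f ^^ n) a) ((g ^^ n) x) = (g ^^ n) (F a x)" for n
    by (induction n) (simp_all add: cov)
  moreover have "F ((inv f ^^ n) a) ((inv g ^^ n) x) = (inv g ^^ n) (F a x)" for n
    by (induction n) (simp_all add: inv)
  ultimately show ?thesis
    by (simp add: funpow_int_def)
qed

lemma funpow_int_eigenvector:
  assumes "unitary U" "z \<in> eigenvalues U" "x \<in> eigenspace U z"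
  shows "funpow_int U k x = (z powi k) *\<^sub>C x"
proof -
  have z: "z \<noteq> 0"
    using eigenvalue_cmod[OF assms(1,2)] by auto
  have bij: "bij U" by (rule unitary_bij[OF assms(1)])
  have lin: "clinear U" by (rule unitary_clinear[OF assms(1)])
  show ?thesis
  proof (induction k rule: int_induct[where k = 0])
    case base
    show ?case by (simp add: funpow_int_def scaleC_one)
  next
    case (step1 i)
    then show ?case
      using z assms(3) by (simp add: funpow_int_Suc[OF bij] clinear_scaleC[OF lin] eigenspace_iff
          scaleC_scaleC power_int_add)
  next
    case (step2 i)
    have "U (funpow_int U (i - 1) x) = (z powi i) *\<^sub>C x"
      using step2 funpow_int_Suc[OF bij, of "i - 1" x] by simp
    also have "z powi i = z powi (i - 1) * z"
      using z power_int_add[of z "i - 1" 1] by simp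
    also have "\<dots> *\<^sub>C x = U ((z powi (i - 1)) *\<^sub>C x)"
      using assms(3) by (simp add: clinear_scaleC[OF lin] eigenspace_iff scaleC_scaleC)
    finally show ?case
      using bij by (simp add: bij_is_inj inj_eq)
  qed
qed

text \<open>The uniform bound makes the set of vectors with limit zero closed, and it is a subspace.
  The factor \<open>s\<close> is left open so that the lemma serves a linear argument
  (\<open>id\<close>) and a conjugate-linear one (\<open>cnj\<close>).\<close>

lemma (in pure_point_unitary) weak_tendsto_zero_left:
  assumes add: "\<And>N x y. g N (x + y) = g N x + (g N y :: complex)"
    and scale: "\<And>N c x. g N (c *\<^sub>C x) = s c * g N x"
    and bound: "\<And>N x. cmod (g N x) \<le> K * norm x"
    and eigen: "\<And>x z. z \<in> eigenvalues U \<Longrightarrow> x \<in> eigenspace U z \<Longrightarrow> (\<lambda>N. g N x) \<longlonglongrightarrow> 0"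
  shows "(\<lambda>N. g N x) \<longlonglongrightarrow> 0"
proof -
  have diff: "g N (x - y) = g N x - g N y" for N x y
    using add[of N "x - y" y] by simp
  have "x \<in> {x. (\<lambda>N. g N x) \<longlonglongrightarrow> 0}"
  proof (rule compact_system_induct[OF compact])
    show "closed {x. (\<lambda>N. g N x) \<longlonglongrightarrow> 0}"
      by (rule closed_tendsto_zero[where K = K]) (metis diff bound)
    show "complex_vector.subspace {x. (\<lambda>N. g N x) \<longlonglongrightarrow> 0}"
      unfolding complex_vector.subspace_def
    proof (intro conjI ballI allI; unfold mem_Collect_eq)
      have "g N 0 = 0" for N
        using diff[of N 0 0] by simp
      then show "(\<lambda>N. g N 0) \<longlonglongrightarrow> 0" by simp
      show "(\<lambda>N. g N (x + y)) \<longlonglongrightarrow> 0"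
        if "(\<lambda>N. g N x) \<longlonglongrightarrow> 0" "(\<lambda>N. g N y) \<longlonglongrightarrow> 0" for x y
        using tendsto_add[OF that] by (simp add: add)
      show "(\<lambda>N. g N (c *\<^sub>C x)) \<longlonglongrightarrow> 0" if "(\<lambda>N. g N x) \<longlonglongrightarrow> 0" for c x
        using tendsto_mult_right_zero[OF that] by (simp add: scale)
    qed
  qed (use eigen in auto)
  then show ?thesis by simp
qed

section \<open>Averages of matrix elements\<close>

context resonance
begin

definition average :: "nat \<Rightarrow> 'h \<Rightarrow> 'h \<Rightarrow> complex"
  where "average N x y = 1 / of_nat N *
    (\<Sum>n<N. cinner (funpow_int U (int n * k\<^sub>1) (A (funpow_int U (int n * (k\<^sub>2 - k\<^sub>1)) x))) y)"

text \<open>Powers of \<open>U\<close> preserve norms, so all terms obey one bound. Its independence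
  of \<open>N\<close> is what the passage from eigenvectors to all vectors needs.\<close>

lemma norm_average_le: "cmod (average N x y) \<le> \<bar>K\<bar> * norm x * norm y"
proof -
  have "cmod (cinner (funpow_int U i (A (funpow_int U j x))) y) \<le> \<bar>K\<bar> * norm x * norm y" for i j
  proof -
    have "norm (A (funpow_int U j x)) \<le> \<bar>K\<bar> * norm (funpow_int U j x)"
      by (rule order_trans[OF bound mult_right_mono]) auto
    then show ?thesis
      by (intro order_trans[OF cauchy_schwarz] mult_right_mono)
        (simp_all add: unitary_norm[OF unitary_funpow_int[OF unitary]])
  qed
  then have "cmod (\<Sum>n<N. cinner (funpow_int U (int n * k\<^sub>1) (A (funpow_int U (int n * (k\<^sub>2 - k\<^sub>1)) x))) y)
      \<le> real N * (\<bar>K\<bar> * norm x * norm y)"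
    by (intro order_trans[OF sum_norm_bound]) auto
  then show ?thesis
    by (cases "N = 0") (simp_all add: average_def norm_mult norm_divide field_simps)
qed

lemma average_eigenvectors:
  assumes v: "v \<in> eigenvalues U" "y \<in> eigenspace U v" and w: "w \<in> eigenvalues U" "x \<in> eigenspace U w"
  shows "(\<lambda>N. average N x y) \<longlonglongrightarrow> cinner (S x) y"
proof -
  define q where "q = v powi k\<^sub>1 * w powi (k\<^sub>2 - k\<^sub>1)"
  have q: "cmod q = 1"
    using v(1) w(1) by (simp add: q_def norm_mult norm_power_int eigenvalue_cmod[OF unitary])
  \<comment> \<open>On the unit circle conjugation is inversion.\<close>
  have cnj: "cnj (v powi (- k)) = v powi k" for k
  proof -
    have "cnj v = inverse v"
      using eigenvalue_cmod[OF unitary v(1)] complex_norm_square[of v]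
      by (metis inverse_unique of_real_1 one_power2)
    then show ?thesis
      by (simp add: power_int_minus power_int_inverse)
  qed
  have "cinner (funpow_int U (int n * k\<^sub>1) (A (funpow_int U (int n * (k\<^sub>2 - k\<^sub>1)) x))) y
      = q ^ n * cinner (A x) y" for n
  proof -
    let ?a = "A (funpow_int U (int n * (k\<^sub>2 - k\<^sub>1)) x)"
    \<comment> \<open>Unitarity moves the outer power of \<open>U\<close> to the second slot as its
      inverse, where it acts on the eigenvector \<open>y\<close> as a scalar.\<close>
    have "y = funpow_int U (int n * k\<^sub>1) (funpow_int U (- (int n * k\<^sub>1)) y)"
      by (simp add: funpow_int_add[OF unitary_bij[OF unitary], symmetric]) (simp add: funpow_int_def)
    then have "cinner (funpow_int U (int n * k\<^sub>1) ?a) y = cinner ?a (funpow_int U (- (int n * k\<^sub>1)) y)"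
      by (metis unitary_cinner[OF unitary_funpow_int[OF unitary]])
    also have "\<dots> = v powi (int n * k\<^sub>1) * w powi (int n * (k\<^sub>2 - k\<^sub>1)) * cinner (A x) y"
      by (simp add: funpow_int_eigenvector[OF unitary v] funpow_int_eigenvector[OF unitary w]
          clinear_scaleC[OF linear] cinner_scaleC_left cinner_scaleC_right cnj del: complex_cnj_power_int)
    also have "v powi (int n * k\<^sub>1) * w powi (int n * (k\<^sub>2 - k\<^sub>1)) = q ^ n"
      by (simp add: q_def power_mult_distrib power_int_mult mult.commute[of "int n"])
    finally show ?thesis .
  qed
  then have "average N x y = (1 / of_nat N * (\<Sum>n<N. q ^ n)) * cinner (A x) y" for N
    by (simp add: average_def sum_distrib_right[symmetric])
  moreover have "cinner (S x) y = (if q = 1 then 1 else 0) * cinner (A x) y"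
    using cinner_S_eigenvectors[OF v(1) w(1) w(2) v(2)] by (simp add: q_def)
  ultimately show ?thesis
    using tendsto_mult_right[OF cesaro_powers[OF q], of "cinner (A x) y"] by simp
qed

lemma average_tendsto: "(\<lambda>N. average N x y) \<longlonglongrightarrow> cinner (S x) y"
proof -
  define g where "g N x y = average N x y - cinner (S x) y" for N x y
  have bound: "cmod (g N x y) \<le> (\<bar>K\<bar> + L) * norm x * norm y" for N x y
  proof -
    have "cmod (cinner (S x) y) \<le> L * norm x * norm y"
      by (rule order_trans[OF cauchy_schwarz mult_right_mono[OF norm_S_le]]) simp
    then show ?thesis
      using norm_average_le[of N x y] norm_triangle_ineq4[of "average N x y" "cinner (S x) y"]
      by (simp add: g_def distrib_right)
  qed
  note lin = linear unitary_clinear[OF unitary_funpow_int[OF unitary]] clinear_S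
  \<comment> \<open>Density is used twice: first \<open>y\<close> is an eigenvector and
    \<open>x\<close> becomes arbitrary, then \<open>x\<close> stays fixed and \<open>y\<close>
    becomes arbitrary.\<close>
  have eigen: "(\<lambda>N. g N x y) \<longlonglongrightarrow> 0" if y: "v \<in> eigenvalues U" "y \<in> eigenspace U v" for v x y
  proof (rule weak_tendsto_zero_left[of "\<lambda>N x. g N x y" id "(\<bar>K\<bar> + L) * norm y"])
    show "g N (x + x') y = g N x y + g N x' y" for N x x'
      by (simp add: g_def average_def clinear_plus lin cinner_add_left sum.distrib algebra_simps
          add_divide_distrib)
    show "g N (c *\<^sub>C x) y = id c * g N x y" for N c x
      by (simp add: g_def average_def clinear_scaleC lin cinner_scaleC_left sum_distrib_left[symmetric]
          algebra_simps)
    show "cmod (g N x y) \<le> (\<bar>K\<bar> + L) * norm y * norm x" for N x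
      using bound[of N x y] by (simp add: mult_ac)
    show "(\<lambda>N. g N x y) \<longlonglongrightarrow> 0" if "w \<in> eigenvalues U" "x \<in> eigenspace U w" for x w
      unfolding g_def LIM_zero_iff using average_eigenvectors[OF y that] .
  qed
  have "(\<lambda>N. g N x y) \<longlonglongrightarrow> 0"
  proof (rule weak_tendsto_zero_left[of "\<lambda>N y. g N x y" cnj "(\<bar>K\<bar> + L) * norm x"])
    show "g N x (y + y') = g N x y + g N x y'" for N y y'
      by (simp add: g_def average_def cinner_add_right sum.distrib algebra_simps add_divide_distrib)
    show "g N x (c *\<^sub>C y) = cnj c * g N x y" for N c y
      by (simp add: g_def average_def cinner_scaleC_right sum_distrib_left[symmetric] algebra_simps)
  qed (rule bound eigen | assumption)+
  then show ?thesis
    unfolding g_def LIM_zero_iff .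
qed

end

section \<open>Passage from correlations in the algebra to matrix elements\<close>

theorem mainTheorem6:
  fixes \<alpha> :: "'a::cstar_algebra \<Rightarrow> 'a" and \<omega> :: "'a \<Rightarrow> complex"
    and \<pi> :: "'a \<Rightarrow> 'h::chilbert_space \<Rightarrow> 'h" and U :: "'h \<Rightarrow> 'h" and \<Omega> :: 'h
    and k\<^sub>1 k\<^sub>2 :: int
  assumes "k\<^sub>1 \<noteq> 0" and "k\<^sub>2 \<noteq> 0" and "k\<^sub>1 \<noteq> k\<^sub>2"
    and "covariant_GNS \<alpha> \<omega> \<pi> U \<Omega>"
    and "compact_system U"
  shows "(\<forall>A. bounded_clinear A \<longrightarrow>
            bounded_clinear (resonant_sum k\<^sub>1 k\<^sub>2 U A) \<and>
            has_sum_strong (\<lambda>(v, w). eigenproj U v \<circ> A \<circ> eigenproj U w)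
              (resonant_sum k\<^sub>1 k\<^sub>2 U A) (resonant_pairs k\<^sub>1 k\<^sub>2 U)) \<and>
         (\<forall>A\<^sub>0 A\<^sub>1 A\<^sub>2.
            (\<lambda>N. 1 / of_nat N *
                 (\<Sum>n<N. \<omega> (A\<^sub>0 * funpow_int \<alpha> (int n * k\<^sub>1) A\<^sub>1 * funpow_int \<alpha> (int n * k\<^sub>2) A\<^sub>2)))
            \<longlonglongrightarrow> cinner (resonant_sum k\<^sub>1 k\<^sub>2 U (\<pi> A\<^sub>1) (\<pi> A\<^sub>2 \<Omega>)) (\<pi> (star A\<^sub>0) \<Omega>))"
proof (intro conjI allI impI)
  interpret GNS: covariant_GNS \<alpha> \<omega> \<pi> U \<Omega> by fact
  have resonance: "\<exists>K. resonance U k\<^sub>1 k\<^sub>2 A K" if A: "bounded_clinear A" for A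
  proof -
    obtain K where K: "clinear A" "\<forall>x. norm (A x) \<le> K * norm x"
      using A unfolding bounded_clinear_def by blast
    have "resonance U k\<^sub>1 k\<^sub>2 A K"
      by unfold_locales (use assms GNS.unitary K in \<open>auto simp: clinear_plus clinear_scaleC\<close>)
    then show ?thesis ..
  qed
  fix A :: "'h \<Rightarrow> 'h" assume "bounded_clinear A"
  then obtain K where "resonance U k\<^sub>1 k\<^sub>2 A K"
    using resonance by blast
  then interpret resonance U k\<^sub>1 k\<^sub>2 A K .
  show "bounded_clinear (resonant_sum k\<^sub>1 k\<^sub>2 U A)"
    unfolding bounded_clinear_def using clinear_S norm_S_le by blast
  show "has_sum_strong (\<lambda>(v, w). eigenproj U v \<circ> A \<circ> eigenproj U w)
      (resonant_sum k\<^sub>1 k\<^sub>2 U A) (resonant_pairs k\<^sub>1 k\<^sub>2 U)"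
    unfolding has_sum_strong_def
  proof
    fix x
    have "(\<lambda>i. (case i of (v, w) \<Rightarrow> eigenproj U v \<circ> A \<circ> eigenproj U w) x) = block x"
      by (auto simp: block_def)
    then show "((\<lambda>i. (case i of (v, w) \<Rightarrow> eigenproj U v \<circ> A \<circ> eigenproj U w) x)
        has_sum resonant_sum k\<^sub>1 k\<^sub>2 U A x) (resonant_pairs k\<^sub>1 k\<^sub>2 U)"
      using block_has_sum by simp
  qed
next
  interpret GNS: covariant_GNS \<alpha> \<omega> \<pi> U \<Omega> by fact
  fix A\<^sub>0 A\<^sub>1 A\<^sub>2
  have rep: "bounded_clinear (\<pi> a)" "\<pi> (a * b) x = \<pi> a (\<pi> b x)"
    "cinner (\<pi> a x) y = cinner x (\<pi> (star a) y)" for a b x y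
    using GNS.representation unfolding star_representation_def is_cadjoint_def by auto
  obtain K where K: "clinear (\<pi> A\<^sub>1)" "\<forall>x. norm (\<pi> A\<^sub>1 x) \<le> K * norm x"
    using rep(1)[of A\<^sub>1] unfolding bounded_clinear_def by blast
  interpret resonance U k\<^sub>1 k\<^sub>2 "\<pi> A\<^sub>1" K
    by unfold_locales (use assms GNS.unitary K in \<open>auto simp: clinear_plus clinear_scaleC\<close>)
  have bij: "bij \<alpha>" "bij U"
    using GNS.automorphism unitary_bij[OF unitary] by (auto simp: star_automorphism_def)
  \<comment> \<open>As the adjoint of \<open>U\<close> is its inverse, covariance by conjugation
    becomes an intertwining relation.\<close>
  have cov: "\<pi> (\<alpha> a) (U x) = U (\<pi> a x)" for a x
  proof -
    have "\<pi> (\<alpha> a) (U x) = U (\<pi> a (inv U (U x)))"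
      unfolding GNS.covariant[symmetric] unitary_cadjoint[OF unitary] by simp
    then show ?thesis
      using bij(2) by (simp add: bij_is_inj)
  qed
  note cov_pow = funpow_int_covariant[where F = \<pi>, OF bij cov]
  \<comment> \<open>Invariance under \<open>inv U\<close> is included because the exponents may be
    negative.\<close>
  have fixed: "funpow_int U k \<Omega> = \<Omega>" for k
  proof -
    have "inv U \<Omega> = \<Omega>"
      using GNS.fixed bij(2) by (metis bij_is_inj inv_f_f)
    moreover have "(f ^^ n) \<Omega> = \<Omega>" if "f \<Omega> = \<Omega>" for f n
      by (induction n) (simp_all add: that)
    ultimately show ?thesis
      by (simp add: funpow_int_def GNS.fixed)
  qed
  \<comment> \<open>Invariance of \<open>\<Omega>\<close> turns the inner power of
    \<open>\<alpha>\<close> into a power of \<open>U\<close>. Splitting its exponent as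
    \<open>n * k\<^sub>1 + n * (k\<^sub>2 - k\<^sub>1)\<close> lets covariance pull the first part
    in front of \<open>\<pi> A\<^sub>1\<close>, and \<open>A\<^sub>0\<close> moves to the second
    slot as its adjoint.\<close>
  have "\<omega> (A\<^sub>0 * funpow_int \<alpha> (int n * k\<^sub>1) A\<^sub>1 * funpow_int \<alpha> (int n * k\<^sub>2) A\<^sub>2)
      = cinner (funpow_int U (int n * k\<^sub>1) (\<pi> A\<^sub>1 (funpow_int U (int n * (k\<^sub>2 - k\<^sub>1)) (\<pi> A\<^sub>2 \<Omega>))))
          (\<pi> (star A\<^sub>0) \<Omega>)" for n
  proof -
    have "\<pi> (funpow_int \<alpha> (int n * k\<^sub>2) A\<^sub>2) \<Omega> = funpow_int U (int n * k\<^sub>2) (\<pi> A\<^sub>2 \<Omega>)"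
      using cov_pow[of "int n * k\<^sub>2" A\<^sub>2 \<Omega>] by (simp add: fixed)
    also have "\<dots> = funpow_int U (int n * k\<^sub>1) (funpow_int U (int n * (k\<^sub>2 - k\<^sub>1)) (\<pi> A\<^sub>2 \<Omega>))"
      by (simp add: funpow_int_add[OF bij(2), symmetric] algebra_simps)
    finally have "\<pi> (funpow_int \<alpha> (int n * k\<^sub>1) A\<^sub>1) (\<pi> (funpow_int \<alpha> (int n * k\<^sub>2) A\<^sub>2) \<Omega>)
        = funpow_int U (int n * k\<^sub>1) (\<pi> A\<^sub>1 (funpow_int U (int n * (k\<^sub>2 - k\<^sub>1)) (\<pi> A\<^sub>2 \<Omega>)))"
      by (simp only: cov_pow)
    then show ?thesis
      by (simp only: GNS.vector_state rep(2,3))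
  qed
  then show "(\<lambda>N. 1 / of_nat N *
        (\<Sum>n<N. \<omega> (A\<^sub>0 * funpow_int \<alpha> (int n * k\<^sub>1) A\<^sub>1 * funpow_int \<alpha> (int n * k\<^sub>2) A\<^sub>2)))
      \<longlonglongrightarrow> cinner (resonant_sum k\<^sub>1 k\<^sub>2 U (\<pi> A\<^sub>1) (\<pi> A\<^sub>2 \<Omega>)) (\<pi> (star A\<^sub>0) \<Omega>)"
    using average_tendsto[of "\<pi> A\<^sub>2 \<Omega>" "\<pi> (star A\<^sub>0) \<Omega>"] by (simp only: average_def)
qed

end
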